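(* Let $R$ be a ring, let $n$ be a positive integer, let $\sigma\colon R\to M_n(R)$ be a ring homomorphism, let $\delta\colon R\to R^n$ be a right $\sigma$-derivation and let $S=R\langle x_1,\dots,x_n;\sigma,\delta\rangle$ be the $(\sigma,\delta)$-free skew extension of $R$ generated by $x_1,\dots,x_n$. Suppose that $\sigma$ is upper triangular and that $\sigma_{ii}\in\operatorname{Aut}(R)$ for all $i=1,\dots,n$. Then the following statements are equivalent. (a) $S$ is a prime ring. (b) $aSb\neq 0$ for all $a,b\in R\setminus\{0\}$.
   Context: Rings are associative with identity element; ring homomorphisms preserve the identity; modules are unital. $R^n$ denotes row vectors with $n$ entries in $R$. For a ring homomorphism $\sigma\colon R\to M_n(R)$, a right $\sigma$-derivation is an additive map $\delta\colon R\to R^n$ with $\delta(rs)=\delta(r)\sigma(s)+r\delta(s)$ for all $r,s\in R$ (matrix product in the first term). Write $\sigma_{ij}(r)$ for the $(i,j)$-entry of $\sigma(r)$ and $\delta_j(r)$ for the $j$-th component of $\delta(r)$. The $(\sigma,\delta)$-free skew extension $S=R\langle x_1,\dots,x_n;\sigma,\delta\rangle$ of $R$ is a ring (unique up to isomorphism) containing $R$ as a subring and an $n$-element subset $X=\{x_1,\dots,x_n\}$ such that (i) the submonoid $\langle X\rangle$ of the multiplicative monoid of $S$ generated by $X$ is free on $X$; (ii) $S$ is a free right $R$-module with basis $\langle X\rangle$; (iii) $rx_j=\sum_{i=1}^n x_i\sigma_{ij}(r)+\delta_j(r)$ for all $j$ and all $r\in R$. $\sigma$ is upper triangular if $\sigma_{ij}$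 is the zero map for all $i>j$; then each $\sigma_{ii}$ is a ring endomorphism of $R$. $\operatorname{Aut}(R)$ is the group of ring automorphisms of $R$. *)

theory Defs
  imports "Jordan_Normal_Form.Matrix"
begin

text \<open>
  Rings are types of class \<open>ring_1\<close>, so they are noncommutative in general and \<open>0 \<noteq> 1\<close>.
  This excludes nothing: over the zero ring no free skew extension exists, since the
  submonoid generated by the single element \<open>0 = 1\<close> is not free on it.
  Indices run over \<open>0, \<dots>, n - 1\<close>.
\<close>

definition two_sided_ideal :: "'a::ring_1 set \<Rightarrow> bool" where
  "two_sided_ideal I \<longleftrightarrow>
     0 \<in> I \<and> (\<forall>a\<in>I. \<forall>b\<in>I. a - b \<in> I) \<and> (\<forall>a\<in>I. \<forall>s. s * a \<in> I \<and> a * s \<in> I)"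

definition ideal_product :: "'a::ring_1 set \<Rightarrow> 'a set \<Rightarrow> 'a set" where
  "ideal_product I J =
     {(\<Sum>k<m. f k * g k) | (m::nat) f g. \<forall>k<m. f k \<in> I \<and> g k \<in> J}"

text \<open>A nonzero ring (nonzero by its type class) is prime if a product of two nonzero
  two-sided ideals is nonzero.\<close>

definition prime_ring :: "'a::ring_1 itself \<Rightarrow> bool" where
  "prime_ring _ \<longleftrightarrow>
     (\<forall>I J :: 'a set. two_sided_ideal I \<and> two_sided_ideal J \<and> I \<noteq> {0} \<and> J \<noteq> {0}
        \<longrightarrow> ideal_product I J \<noteq> {0})"

definition matrix_ring_hom :: "nat \<Rightarrow> ('r::ring_1 \<Rightarrow> 'r mat) \<Rightarrow> bool" where
  "matrix_ring_hom n \<sigma> \<longleftrightarrow>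
     (\<forall>r. \<sigma> r \<in> carrier_mat n n) \<and> \<sigma> 1 = 1\<^sub>m n \<and>
     (\<forall>r s. \<sigma> (r + s) = \<sigma> r + \<sigma> s) \<and> (\<forall>r s. \<sigma> (r * s) = \<sigma> r * \<sigma> s)"

text \<open>The row vector \<open>v\<close> times the matrix \<open>A\<close>, with entries \<open>\<Sum>i. v\<^sub>i * A\<^sub>i\<^sub>j\<close>; the order of
  the factors matters. (The library only has matrix times column vector.)\<close>

definition row_vec_mult :: "'r::ring_1 vec \<Rightarrow> 'r mat \<Rightarrow> 'r vec" where
  "row_vec_mult v A = vec (dim_col A) (\<lambda>j. v \<bullet> col A j)"

definition right_derivation ::
    "nat \<Rightarrow> ('r::ring_1 \<Rightarrow> 'r mat) \<Rightarrow> ('r \<Rightarrow> 'r vec) \<Rightarrow> bool" where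
  "right_derivation n \<sigma> \<delta> \<longleftrightarrow>
     (\<forall>r. \<delta> r \<in> carrier_vec n) \<and>
     (\<forall>r s. \<delta> (r + s) = \<delta> r + \<delta> s) \<and>
     (\<forall>r s. \<delta> (r * s) = row_vec_mult (\<delta> r) (\<sigma> s) + r \<cdot>\<^sub>v \<delta> s)"

text \<open>The elements of the submonoid generated by \<open>X\<close> are the products of finite words
  (including the empty one) over \<open>X\<close>; it is free on \<open>X\<close> if distinct words have distinct
  products.\<close>

definition generated_submonoid :: "'s::monoid_mult set \<Rightarrow> 's set" where
  "generated_submonoid X = prod_list ` lists X"

definition free_on :: "'s::monoid_mult set \<Rightarrow> bool" where
  "free_on X \<longleftrightarrow> inj_on prod_list (lists X)"

text \<open>\<open>B\<close> is a basis of \<open>S\<close> as a right module over \<open>R\<close>, which acts by right multiplication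
  along \<open>\<iota>\<close>. (The library's \<open>module\<close> locale is limited to commutative scalars.)\<close>

definition right_module_basis :: "('r::ring_1 \<Rightarrow> 's::ring_1) \<Rightarrow> 's set \<Rightarrow> bool" where
  "right_module_basis \<iota> B \<longleftrightarrow>
     (\<forall>s. \<exists>F c. finite F \<and> F \<subseteq> B \<and> s = (\<Sum>b\<in>F. b * \<iota> (c b))) \<and>
     (\<forall>F c. finite F \<and> F \<subseteq> B \<and> (\<Sum>b\<in>F. b * \<iota> (c b)) = 0 \<longrightarrow> (\<forall>b\<in>F. c b = 0))"

text \<open>The ring \<open>'s\<close> is a \<open>(\<sigma>,\<delta>)\<close>-free skew extension of \<open>'r\<close> generated by
  \<open>x 0, \<dots>, x (n - 1)\<close>. The inclusion of the subring \<open>R\<close> into \<open>S\<close> is rendered as the injective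
  ring homomorphism \<open>\<iota>\<close>.\<close>

definition free_skew_extension ::
    "nat \<Rightarrow> ('r::ring_1 \<Rightarrow> 'r mat) \<Rightarrow> ('r \<Rightarrow> 'r vec) \<Rightarrow> ('r \<Rightarrow> 's::ring_1) \<Rightarrow> (nat \<Rightarrow> 's) \<Rightarrow> bool"
  where
  "free_skew_extension n \<sigma> \<delta> \<iota> x \<longleftrightarrow>
     inj_ring_hom \<iota> \<and> inj_on x {..<n} \<and>
     free_on (x ` {..<n}) \<and>
     right_module_basis \<iota> (generated_submonoid (x ` {..<n})) \<and>
     (\<forall>r. \<forall>j<n. \<iota> r * x j = (\<Sum>i<n. x i * \<iota> (\<sigma> r $$ (i, j))) + \<iota> (\<delta> r $ j))"

end

theory Submission
  imports Defs "HOL-Library.List_Lenlexorder"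
begin

text \<open>
  Order words by length, then lexicographically. Since \<open>\<sigma>\<close> is upper triangular,
  \<open>r w = w \<sigma>\<^sub>w(r) + lower terms\<close> for an automorphism \<open>\<sigma>\<^sub>w\<close> composed from the diagonal maps.
  Hence every element also has an expansion with coefficients on the left of the words.

  Let \<open>I J = 0\<close> for nonzero ideals \<open>I\<close> and \<open>J\<close>. Choose \<open>f = u a + lower terms\<close> in \<open>I\<close> with minimal
  leading word \<open>u\<close>, and let \<open>g = \<Sum> g\<^sub>w w\<close> be in \<open>J\<close>. In \<open>0 = f g = \<Sum> (f g\<^sub>w) w\<close> each \<open>f g\<^sub>w \<in> I\<close> is zero or
  has leading word exactly \<open>u\<close>, so nonzero summands have distinct leading words \<open>u w\<close>. Thus all
  \<open>f g\<^sub>w\<close> vanish, which gives \<open>a g\<^sub>w = 0\<close> and \<open>a J = 0\<close>. Symmetrically, a suitable nonzero \<open>b \<in> R\<close>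
  is annihilated from the left by every element that annihilates \<open>J\<close>, in particular by \<open>a S\<close>.
\<close>

section \<open>The length-lexicographic order on words\<close>

text \<open>Comparing lengths first is essential: in the plain lexicographic order
  \<open>[] < [0]\<close>, but appending \<open>[1]\<close> to both reverses the comparison.\<close>

lemma append_less_mono_right:
  fixes u v w :: "'a::linorder list"
  shows "u < v \<Longrightarrow> u @ w < v @ w"
  unfolding list_less_def by (rule lenlex_append1) simp_all

lemma append_less_mono_left:
  fixes u v w :: "'a::linorder list"
  shows "u < v \<Longrightarrow> w @ u < w @ v"
  unfolding list_less_def by (subst lenlex_append2) (auto simp: irrefl_def)

section \<open>Ideals and primeness\<close>

lemma two_sided_idealD:
  assumes "two_sided_ideal I"
  shows "a \<in> I \<Longrightarrow> s * a \<in> I" "a \<in> I \<Longrightarrow> a * s \<in> I" "0 \<in> I"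
  using assms by (auto simp: two_sided_ideal_def)

lemma ideal_product_eq_zero_iff:
  assumes "two_sided_ideal I" "two_sided_ideal J"
  shows "ideal_product I J = {0} \<longleftrightarrow> (\<forall>f\<in>I. \<forall>g\<in>J. f * g = 0)"
proof
  assume *: "ideal_product I J = {0}"
  have "f * g \<in> ideal_product I J" if "f \<in> I" "g \<in> J" for f g
    unfolding ideal_product_def mem_Collect_eq
    by (rule exI[of _ 1], rule exI[of _ "\<lambda>_. f"], rule exI[of _ "\<lambda>_. g"]) (use that in simp)
  with * show "\<forall>f\<in>I. \<forall>g\<in>J. f * g = 0" by blast
next
  assume *: "\<forall>f\<in>I. \<forall>g\<in>J. f * g = 0"
  have "0 \<in> ideal_product I J"
    unfolding ideal_product_def mem_Collect_eq by (rule exI[of _ 0]) simp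
  moreover have "ideal_product I J \<subseteq> {0}"
    using * by (auto simp: ideal_product_def intro!: sum.neutral)
  ultimately show "ideal_product I J = {0}" by blast
qed

lemma prime_ring_mult_eq_zero:
  fixes a b :: "'s::ring_1"
  assumes "prime_ring TYPE('s)" and "\<forall>s. a * s * b = 0"
  shows "a = 0 \<or> b = 0"
proof -
  \<comment> \<open>Annihilators replace the ideals generated by \<open>a\<close> and \<open>b\<close>.\<close>
  define I where "I = {y. \<forall>s. y * s * b = 0}"
  define J where "J = {z. \<forall>y\<in>I. y * z = 0}"
  have mult_I: "t * y \<in> I" "y * t \<in> I" if "y \<in> I" for y t
    using that unfolding I_def mem_Collect_eq by (metis mult.assoc mult_zero_right)+
  have "two_sided_ideal I"
    unfolding two_sided_ideal_def using mult_I by (auto simp: I_def left_diff_distrib)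
  moreover have "two_sided_ideal J"
    unfolding two_sided_ideal_def
  proof (intro conjI ballI allI)
    fix z s assume "z \<in> J"
    then show "s * z \<in> J" "z * s \<in> J"
      using mult_I(2) by (auto simp: J_def simp flip: mult.assoc)
  qed (auto simp: J_def right_diff_distrib)
  moreover have "\<forall>f\<in>I. \<forall>g\<in>J. f * g = 0" by (auto simp: J_def)
  ultimately have "I = {0} \<or> J = {0}"
    using assms(1) ideal_product_eq_zero_iff unfolding prime_ring_def by blast
  moreover have "a \<in> I" using assms(2) by (simp add: I_def)
  \<comment> \<open>The instance \<open>s = 1\<close> in the definition of \<open>I\<close> gives
    \<open>y * b = 0\<close>.\<close>
  moreover have "b \<in> J"
    unfolding J_def I_def by (auto dest: spec[of _ 1])
  ultimately show ?thesis by blast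
qed

section \<open>Monomials and their right spans\<close>

locale triangular_skew_extension =
  fixes n :: nat
    and \<sigma> :: "'r::ring_1 \<Rightarrow> 'r mat"
    and \<delta> :: "'r \<Rightarrow> 'r vec"
    and \<iota> :: "'r \<Rightarrow> 's::ring_1"
    and x :: "nat \<Rightarrow> 's"
  assumes sigma_hom: "matrix_ring_hom n \<sigma>"
    and ext: "free_skew_extension n \<sigma> \<delta> \<iota> x"
    and tri: "\<And>r. upper_triangular (\<sigma> r)"
    and diag: "\<And>i. i < n \<Longrightarrow> ring_isom (\<lambda>r. \<sigma> r $$ (i, i))"
begin

sublocale iota: inj_ring_hom \<iota>
  using ext by (simp add: free_skew_extension_def)

abbreviation words :: "nat list set" where
  "words \<equiv> lists {..<n}"

text \<open>Indexing the basis by lists of letter indices makes the order and induction on lists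
  available.\<close>

definition monom :: "nat list \<Rightarrow> 's" where
  "monom w = prod_list (map x w)"

lemma monom_Nil [simp]: "monom [] = 1"
  and monom_append: "monom (u @ v) = monom u * monom v"
  and monom_singleton [simp]: "monom [j] = x j"
  by (simp_all add: monom_def)

lemma monom_image: "monom ` words = generated_submonoid (x ` {..<n})"
  by (simp add: monom_def generated_submonoid_def lists_image image_image)

lemma inj_on_monom: "inj_on monom words"
proof -
  have "inj_on (map x) words"
    using ext by (simp add: free_skew_extension_def inj_on_map_lists)
  moreover have "inj_on prod_list (map x ` words)"
    using ext by (simp add: free_skew_extension_def free_on_def lists_image)
  ultimately show ?thesis
    unfolding monom_def using comp_inj_on by (fastforce simp: comp_def)
qed

definition span :: "nat list set \<Rightarrow> 's set" where
  "span A = {\<Sum>w\<in>F. monom w * \<iota> (c w) | F c. finite F \<and> F \<subseteq> A}"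

lemma in_span_words: "s \<in> span words"
proof -
  obtain F c where F: "finite F" "F \<subseteq> monom ` words" "s = (\<Sum>b\<in>F. b * \<iota> (c b))"
    using ext unfolding free_skew_extension_def right_module_basis_def monom_image by metis
  then obtain G where G: "finite G" "G \<subseteq> words" "F = monom ` G"
    by (meson finite_subset_image)
  have "s = (\<Sum>w\<in>G. monom w * \<iota> (c (monom w)))"
    unfolding F(3) G(3) by (rule sum.reindex_cong[OF inj_on_subset[OF inj_on_monom G(2)]]) auto
  then show ?thesis unfolding span_def mem_Collect_eq using G(1,2)
    by (intro exI[of _ G] exI[of _ "\<lambda>w. c (monom w)"] conjI)
qed

lemma monom_independent:
  assumes "finite F" "F \<subseteq> words" "(\<Sum>w\<in>F. monom w * \<iota> (c w)) = 0" "w \<in> F"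
  shows "c w = 0"
proof -
  have inj: "inj_on monom F" using inj_on_monom assms(2) by (rule inj_on_subset)
  \<comment> \<open>The basis property wants coefficients indexed by elements of the ring, so
    \<open>c\<close> is transported along the inverse of \<open>monom\<close>.\<close>
  have "(\<Sum>b\<in>monom ` F. b * \<iota> (c (inv_into F monom b))) = 0"
    using assms(3) inj by (subst sum.reindex[OF inj]) (simp cong: sum.cong)
  moreover have "finite (monom ` F)" "monom ` F \<subseteq> generated_submonoid (x ` {..<n})"
    using assms(1,2) by (auto simp flip: monom_image)
  moreover have "\<forall>F c. finite F \<and> F \<subseteq> generated_submonoid (x ` {..<n}) \<and>
      (\<Sum>b\<in>F. b * \<iota> (c b)) = 0 \<longrightarrow> (\<forall>b\<in>F. c b = 0)"
    using ext unfolding free_skew_extension_def right_module_basis_def by (elim conjE)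
  ultimately have "\<forall>b\<in>monom ` F. c (inv_into F monom b) = 0"
    by (elim allE[of _ "monom ` F"] allE[of _ "\<lambda>b. c (inv_into F monom b)"]) simp
  then show ?thesis using assms(4) inj by simp
qed

lemma span_zero [simp]: "0 \<in> span A"
  unfolding span_def by (auto intro!: exI[of _ "{}"])

lemma span_monom: "w \<in> A \<Longrightarrow> monom w * \<iota> r \<in> span A"
  unfolding span_def by (auto intro!: exI[of _ "{w}"] exI[of _ "\<lambda>_. r"])

lemma span_mono: "A \<subseteq> B \<Longrightarrow> span A \<subseteq> span B"
  unfolding span_def by blast

lemma span_add:
  assumes "p \<in> span A" "q \<in> span A"
  shows "p + q \<in> span A"
proof -
  obtain F c where F: "finite F" "F \<subseteq> A" "p = (\<Sum>w\<in>F. monom w * \<iota> (c w))"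
    using assms(1) unfolding span_def by blast
  obtain G d where G: "finite G" "G \<subseteq> A" "q = (\<Sum>w\<in>G. monom w * \<iota> (d w))"
    using assms(2) unfolding span_def by blast
  \<comment> \<open>Extension by zero puts both sums over the same index set.\<close>
  let ?c = "\<lambda>w. if w \<in> F then c w else 0" and ?d = "\<lambda>w. if w \<in> G then d w else 0"
  have "p = (\<Sum>w\<in>F \<union> G. monom w * \<iota> (?c w))"
    unfolding F(3) using F(1) G(1) by (intro sum.mono_neutral_cong_left) auto
  moreover have "q = (\<Sum>w\<in>F \<union> G. monom w * \<iota> (?d w))"
    unfolding G(3) using F(1) G(1) by (intro sum.mono_neutral_cong_left) auto
  ultimately have "p + q = (\<Sum>w\<in>F \<union> G. monom w * \<iota> (?c w + ?d w))"
    by (simp only: iota.hom_add distrib_left sum.distrib)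
  moreover have "finite (F \<union> G)" "F \<union> G \<subseteq> A" using F G by auto
  ultimately show ?thesis unfolding span_def mem_Collect_eq
    by (intro exI[of _ "F \<union> G"] exI[of _ "\<lambda>w. ?c w + ?d w"] conjI)
qed

lemma span_sum:
  assumes "\<And>i. i \<in> F \<Longrightarrow> f i \<in> span A"
  shows "sum f F \<in> span A"
proof (cases "finite F")
  case True
  then show ?thesis using assms by induction (auto intro: span_add)
qed simp

text \<open>Reduces the effect of a multiplication on a span to single terms. Only additivity is
  asked of \<open>h\<close>, since right multiplication by a letter or a scalar need not respect the
  right module structure.\<close>

lemma span_map:
  assumes "p \<in> span A"
    and "\<And>w r. w \<in> A \<Longrightarrow> h (monom w * \<iota> r) \<in> span B"
    and "\<And>p q. h (p + q) = h p + h q"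
  shows "h p \<in> span B"
proof -
  obtain F c where F: "finite F" "F \<subseteq> A" "p = (\<Sum>w\<in>F. monom w * \<iota> (c w))"
    using assms(1) unfolding span_def by blast
  have "h 0 = 0" using assms(3)[of 0 0] by simp
  have "h p = (\<Sum>w\<in>F. h (monom w * \<iota> (c w)))"
    unfolding F(3) using F(1) \<open>h 0 = 0\<close> by (induction F) (auto simp: assms(3))
  then show ?thesis using F(2) assms(2) by (auto intro: span_sum)
qed

lemma span_scale: "p \<in> span A \<Longrightarrow> p * \<iota> r \<in> span A"
  by (rule span_map[where h = "\<lambda>p. p * \<iota> r"])
    (auto simp: mult.assoc distrib_right simp flip: iota.hom_mult intro: span_monom)

section \<open>Commutation modulo smaller words\<close>

definition below :: "nat list \<Rightarrow> nat list set" where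
  "below v = {w \<in> words. w < v}"

lemma below_mono: "p \<in> span (below u) \<Longrightarrow> u \<le> v \<Longrightarrow> p \<in> span (below v)"
  by (rule subsetD[OF span_mono, of "below u"]) (auto simp: below_def)

lemma monom_mult_below:
  assumes "p \<in> span (below v)" "u \<in> words"
  shows "monom u * p \<in> span (below (u @ v))"
proof (rule span_map[OF assms(1), where h = "(*) (monom u)"])
  fix w r assume "w \<in> below v"
  then have "u @ w \<in> below (u @ v)" using assms(2) by (auto simp: below_def append_less_mono_left)
  then show "monom u * (monom w * \<iota> r) \<in> span (below (u @ v))"
    using span_monom by (fastforce simp: monom_append simp flip: mult.assoc)
qed (simp add: distrib_left)

text \<open>The automorphism \<open>\<sigma>\<^sub>w\<close> that moves a coefficient past the word \<open>w\<close>.\<close>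

fun twist :: "nat list \<Rightarrow> 'r \<Rightarrow> 'r" where
  "twist [] r = r"
| "twist (j # v) r = twist v (\<sigma> r $$ (j, j))"

lemma twist_append: "twist (u @ v) r = twist v (twist u r)"
  by (induction u arbitrary: r) auto

text \<open>The assumption on the diagonal enters here. Later, surjectivity moves coefficients to
  the left of words, and injectivity keeps leading coefficients nonzero.\<close>

lemma ring_isom_twist: "v \<in> words \<Longrightarrow> ring_isom (twist v)"
proof (induction v)
  case Nil
  then show ?case by unfold_locales (auto intro: surjI)
next
  case (Cons j v)
  then interpret t: ring_isom "twist v" by simp
  interpret d: ring_isom "\<lambda>r. \<sigma> r $$ (j, j)" using Cons.prems diag by simp
  show ?case
  proof unfold_locales
    show "surj (twist (j # v))"
      using comp_surj[OF d.surj t.surj] by (simp add: comp_def)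
  qed (auto simp: d.hom_add t.hom_add d.hom_mult t.hom_mult)
qed

text \<open>Upper triangularity cuts the commutation rule off at the diagonal.\<close>

lemma commutation:
  assumes "j < n"
  shows "\<iota> r * x j = (\<Sum>i<j. x i * \<iota> (\<sigma> r $$ (i, j))) + x j * \<iota> (\<sigma> r $$ (j, j)) + \<iota> (\<delta> r $ j)"
proof -
  have "(\<Sum>i<n. x i * \<iota> (\<sigma> r $$ (i, j))) = (\<Sum>i<Suc j. x i * \<iota> (\<sigma> r $$ (i, j)))"
  proof (rule sum.mono_neutral_right)
    have "dim_row (\<sigma> r) = n" using sigma_hom by (auto simp: matrix_ring_hom_def)
    then show "\<forall>i\<in>{..<n} - {..<Suc j}. x i * \<iota> (\<sigma> r $$ (i, j)) = 0"
      using tri[of r] by (auto simp: upper_triangular_def)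
  qed (use assms in auto)
  then show ?thesis
    using ext assms by (auto simp: free_skew_extension_def)
qed

text \<open>The letters \<open>x i\<close> with \<open>i < j\<close> are smaller words of equal
  length, and the \<open>\<delta>\<close> term sits at the empty word, which is shorter.\<close>

lemma iota_mult_letter:
  assumes "j < n"
  shows "\<iota> r * x j - x j * \<iota> (\<sigma> r $$ (j, j)) \<in> span (below [j])"
proof -
  have "\<iota> (\<delta> r $ j) \<in> span (below [j])"
    using span_monom[of "[]" "below [j]"] by (simp add: below_def)
  moreover have "x i * \<iota> s \<in> span (below [j])" if "i < j" for i s
    using span_monom[of "[i]" "below [j]"] that assms by (simp add: below_def Cons_less_Cons)
  ultimately show ?thesis
    unfolding commutation[OF assms] by (auto intro!: span_add span_sum)
qed

text \<open>Exchanging \<open>\<iota> r\<close> and \<open>x j\<close> in a term at \<open>w\<close>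
  yields a term at \<open>w @ [j]\<close> and terms below it; since \<open>w < u\<close>, all stay
  below \<open>u @ [j]\<close>.\<close>

lemma below_mult_letter:
  assumes "p \<in> span (below u)" "j < n"
  shows "p * x j \<in> span (below (u @ [j]))"
proof (rule span_map[OF assms(1), where h = "\<lambda>p. p * x j"])
  fix w r assume w: "w \<in> below u"
  then have "w \<in> words" "w @ [j] \<in> below (u @ [j])"
    using assms(2) by (auto simp: below_def append_less_mono_right)
  then have "monom w * (\<iota> r * x j - x j * \<iota> (\<sigma> r $$ (j, j))) \<in> span (below (u @ [j]))"
    by (intro below_mono[OF monom_mult_below[OF iota_mult_letter[OF assms(2)]]])
      (auto simp: below_def)
  moreover have "monom (w @ [j]) * \<iota> (\<sigma> r $$ (j, j)) \<in> span (below (u @ [j]))"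
    using \<open>w @ [j] \<in> below (u @ [j])\<close> by (rule span_monom)
  ultimately have "monom w * (\<iota> r * x j - x j * \<iota> (\<sigma> r $$ (j, j)))
      + monom (w @ [j]) * \<iota> (\<sigma> r $$ (j, j)) \<in> span (below (u @ [j]))"
    by (rule span_add)
  then show "monom w * \<iota> r * x j \<in> span (below (u @ [j]))"
    by (simp add: monom_append right_diff_distrib mult.assoc)
qed (simp add: distrib_right)

lemma below_mult_monom:
  assumes "p \<in> span (below u)" "v \<in> words"
  shows "p * monom v \<in> span (below (u @ v))"
  using assms(2)
proof (induction v rule: rev_induct)
  case Nil
  then show ?case using assms by simp
next
  case (snoc j v)
  then show ?case
    using below_mult_letter[of "p * monom v" "u @ v" j] by (simp add: monom_append mult.assoc)
qed

lemma iota_mult_monom: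
  assumes "v \<in> words"
  shows "\<iota> r * monom v - monom v * \<iota> (twist v r) \<in> span (below v)"
  using assms
proof (induction v rule: rev_induct)
  case (snoc j v)
  let ?t = "twist v r"
  \<comment> \<open>The two errors, from passing \<open>v\<close> and then \<open>x j\<close>,
    telescope: the middle term \<open>monom v * \<iota> ?t * x j\<close> cancels.\<close>
  have "(\<iota> r * monom v - monom v * \<iota> ?t) * x j \<in> span (below (v @ [j]))"
    using snoc by (auto intro: below_mult_letter)
  moreover have "monom v * (\<iota> ?t * x j - x j * \<iota> (\<sigma> ?t $$ (j, j))) \<in> span (below (v @ [j]))"
    using snoc.prems by (auto intro: monom_mult_below iota_mult_letter)
  ultimately have "(\<iota> r * monom v - monom v * \<iota> ?t) * x j
      + monom v * (\<iota> ?t * x j - x j * \<iota> (\<sigma> ?t $$ (j, j))) \<in> span (below (v @ [j]))"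
    by (rule span_add)
  then show ?case
    by (simp add: monom_append twist_append algebra_simps)
qed simp

section \<open>Leading terms\<close>

text \<open>The coefficient \<open>b\<close> may be zero, so that multiplication rules need no side conditions.\<close>

definition leading :: "nat list \<Rightarrow> 'r \<Rightarrow> 's \<Rightarrow> bool" where
  "leading v b g \<longleftrightarrow> v \<in> words \<and> g - monom v * \<iota> b \<in> span (below v)"

lemma leading_exists:
  assumes "g \<noteq> 0"
  shows "\<exists>v b. b \<noteq> 0 \<and> leading v b g"
proof -
  obtain F c where F: "finite F" "F \<subseteq> words" "g = (\<Sum>w\<in>F. monom w * \<iota> (c w))"
    using in_span_words[of g] unfolding span_def by blast
  have "\<exists>v b. b \<noteq> 0 \<and> leading v b (\<Sum>w\<in>F. monom w * \<iota> (c w))"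
    if "(\<Sum>w\<in>F. monom w * \<iota> (c w)) \<noteq> 0"
    using F(1,2) that
  proof (induction F rule: finite_linorder_max_induct)
    case (insert v F)
    show ?case
    proof (cases "c v = 0")
      case True
      then show ?thesis using insert by auto
    next
      case False
      have "leading v (c v) (\<Sum>w\<in>insert v F. monom w * \<iota> (c w))"
        using insert.hyps insert.prems unfolding leading_def
        by (subst sum.insert) (auto intro!: span_sum span_monom simp: below_def)
      with False show ?thesis by blast
    qed
  qed simp
  with assms F(3) show ?thesis by simp
qed

text \<open>Linear independence of the monomials enters here; the comparisons of leading terms below
  rest on it.\<close>

lemma leading_zero_imp:
  assumes "leading v b 0"
  shows "b = 0"
proof -
  have v: "v \<in> words" and "- (monom v * \<iota> b) \<in> span (below v)"
    using assms by (auto simp: leading_def)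
  then obtain F c where F: "finite F" "F \<subseteq> below v" "- (monom v * \<iota> b) = (\<Sum>w\<in>F. monom w * \<iota> (c w))"
    unfolding span_def by blast
  have "v \<notin> F" using F(2) by (auto simp: below_def)
  \<comment> \<open>Moving the leading term to the other side gives one relation over
    \<open>insert v F\<close>, whose coefficient at \<open>v\<close> is \<open>b\<close>.\<close>
  define d where "d = c(v := b)"
  have "(\<Sum>w\<in>F. monom w * \<iota> (d w)) = (\<Sum>w\<in>F. monom w * \<iota> (c w))"
    using \<open>v \<notin> F\<close> by (intro sum.cong) (auto simp: d_def)
  then have "(\<Sum>w\<in>insert v F. monom w * \<iota> (d w)) = 0"
    using F(1) \<open>v \<notin> F\<close> by (simp add: d_def flip: F(3))
  then have "d v = 0"
    using F v by (intro monom_independent[of "insert v F"]) (auto simp: below_def)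
  then show ?thesis by (simp add: d_def)
qed

lemma leading_add_below: "leading v b g \<Longrightarrow> p \<in> span (below v) \<Longrightarrow> leading v b (g + p)"
  unfolding leading_def using span_add[of "g - monom v * \<iota> b" _ p] by (simp add: algebra_simps)

lemma leading_imp_below:
  assumes "leading u b g" "u < v"
  shows "g \<in> span (below v)"
proof -
  have "monom u * \<iota> b \<in> span (below v)"
    using assms by (auto simp: leading_def below_def intro: span_monom)
  moreover have "g - monom u * \<iota> b \<in> span (below v)"
    using assms by (intro below_mono[of _ u v]) (auto simp: leading_def)
  ultimately have "monom u * \<iota> b + (g - monom u * \<iota> b) \<in> span (below v)" by (rule span_add)
  then show ?thesis by simp
qed

lemma leading_zero_coeff: "leading v 0 g \<Longrightarrow> g \<in> span (below v)"
  by (simp add: leading_def)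

lemma below_imp_leading_less:
  assumes "g \<in> span (below v)" "leading u b g" "b \<noteq> 0"
  shows "u < v"
proof (rule ccontr)
  assume "\<not> u < v"
  then have "g \<in> span (below u)" using assms(1) by (intro below_mono[of _ v u]) auto
  \<comment> \<open>Negation is right multiplication by \<open>\<iota> (- 1)\<close>. Adding
    \<open>- g\<close> to \<open>g\<close> would then give 0 the nonzero leading coefficient
    \<open>b\<close>.\<close>
  then have "- g \<in> span (below u)" using span_scale[of g _ "- 1"] by (simp add: iota.hom_uminus)
  with assms(2) have "leading u b (g + - g)" by (rule leading_add_below)
  then show False using leading_zero_imp assms(3) by simp
qed

lemma leading_monom_mult:
  "leading v b g \<Longrightarrow> u \<in> words \<Longrightarrow> leading (u @ v) b (monom u * g)"
  unfolding leading_def using monom_mult_below[of "g - monom v * \<iota> b" v u]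
  by (auto simp: monom_append algebra_simps)

lemma leading_mult_iota: "leading v b g \<Longrightarrow> leading v (b * r) (g * \<iota> r)"
  unfolding leading_def using span_scale[of "g - monom v * \<iota> b" "below v" r]
  by (auto simp: algebra_simps iota.hom_mult)

text \<open>Passing \<open>r\<close> through \<open>v\<close> twists it. A smaller word
  \<open>w\<close> only yields words up to \<open>w\<close>, so the lower terms cannot reach
  \<open>v\<close>.\<close>

lemma leading_iota_mult:
  assumes "leading v b g"
  shows "leading v (twist v r * b) (\<iota> r * g)"
proof -
  have v: "v \<in> words" and g: "g - monom v * \<iota> b \<in> span (below v)"
    using assms by (auto simp: leading_def)
  have "(\<iota> r * monom v - monom v * \<iota> (twist v r)) * \<iota> b \<in> span (below v)"
    by (intro span_scale iota_mult_monom v)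
  moreover have "\<iota> r * (g - monom v * \<iota> b) \<in> span (below v)"
  proof (rule span_map[OF g, where h = "(*) (\<iota> r)"])
    fix w s assume w: "w \<in> below v"
    then have "\<iota> r * monom w - monom w * \<iota> (twist w r) \<in> span (below v)"
      by (intro below_mono[OF iota_mult_monom]) (auto simp: below_def)
    then have "(\<iota> r * monom w - monom w * \<iota> (twist w r)) * \<iota> s \<in> span (below v)"
      by (rule span_scale)
    moreover have "monom w * \<iota> (twist w r * s) \<in> span (below v)" using w by (rule span_monom)
    ultimately have "(\<iota> r * monom w - monom w * \<iota> (twist w r)) * \<iota> s
        + monom w * \<iota> (twist w r * s) \<in> span (below v)" by (rule span_add)
    then show "\<iota> r * (monom w * \<iota> s) \<in> span (below v)"
      by (simp add: algebra_simps iota.hom_mult)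
  qed (simp add: distrib_left)
  ultimately have "(\<iota> r * monom v - monom v * \<iota> (twist v r)) * \<iota> b
      + \<iota> r * (g - monom v * \<iota> b) \<in> span (below v)" by (rule span_add)
  then show ?thesis
    using v unfolding leading_def by (simp add: algebra_simps iota.hom_mult)
qed

lemma leading_mult_monom:
  assumes "leading u a f" "v \<in> words"
  shows "leading (u @ v) (twist v a) (f * monom v)"
proof -
  have u: "u \<in> words" and f: "f - monom u * \<iota> a \<in> span (below u)"
    using assms by (auto simp: leading_def)
  have "(f - monom u * \<iota> a) * monom v \<in> span (below (u @ v))"
    using f assms(2) by (rule below_mult_monom)
  moreover have "monom u * (\<iota> a * monom v - monom v * \<iota> (twist v a)) \<in> span (below (u @ v))"
    using u assms(2) by (intro monom_mult_below iota_mult_monom)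
  ultimately have "(f - monom u * \<iota> a) * monom v
      + monom u * (\<iota> a * monom v - monom v * \<iota> (twist v a)) \<in> span (below (u @ v))"
    by (rule span_add)
  then show ?thesis
    using u assms(2) unfolding leading_def by (simp add: algebra_simps monom_append)
qed

text \<open>A nonzero summand of largest index would dominate all others, as \<open>m\<close> is
  strictly increasing; so the summands are peeled off from the top.\<close>

lemma sum_eq_zero_distinct_leading:
  fixes m :: "nat list \<Rightarrow> nat list"
  assumes "finite F" "(\<Sum>w\<in>F. h w) = 0"
    and "\<And>w. w \<in> F \<Longrightarrow> h w = 0 \<or> (\<exists>b. b \<noteq> 0 \<and> leading (m w) b (h w))"
    and "\<And>u v. u < v \<Longrightarrow> m u < m v"
    and "w \<in> F"
  shows "h w = 0"
  using assms(1,2,3,5)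
proof (induction F arbitrary: w rule: finite_linorder_max_induct)
  case (insert v F)
  have "h v = 0"
  proof (rule ccontr)
    assume "h v \<noteq> 0"
    then obtain b where b: "b \<noteq> 0" "leading (m v) b (h v)" using insert.prems by auto
    have "sum h F \<in> span (below (m v))"
    proof (rule span_sum)
      fix u assume "u \<in> F"
      then show "h u \<in> span (below (m v))"
        using insert.prems(2)[of u] insert.hyps assms(4)[of u v] leading_imp_below by auto
    qed
    then have "leading (m v) b (h v + sum h F)" by (intro leading_add_below b)
    moreover have "h v + sum h F = 0"
      using insert.prems(1) insert.hyps by (subst (asm) sum.insert) auto
    ultimately show False using leading_zero_imp b(1) by simp
  qed
  moreover have "v \<notin> F" using insert.hyps by auto
  ultimately show ?case using insert by auto
qed simp

section \<open>Minimal leading words and constant annihilators\<close>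

text \<open>The order on words of naturals is a well-order. Minimality is phrased so that an element
  of \<open>J\<close> vanishes as soon as its coefficient at \<open>v\<close> does and nothing above
  \<open>v\<close> occurs.\<close>

lemma minimal_leading:
  assumes "J \<noteq> {}" "J \<noteq> {0}"
  obtains g v b where "g \<in> J" "b \<noteq> 0" "leading v b g"
    "\<And>h. h \<in> J \<Longrightarrow> h \<in> span (below v) \<Longrightarrow> h = 0"
proof -
  define P where "P v \<longleftrightarrow> (\<exists>g\<in>J. \<exists>b. b \<noteq> 0 \<and> leading v b g)" for v
  obtain g where "g \<in> J" "g \<noteq> 0" using assms by blast
  then have "\<exists>v. P v" using leading_exists unfolding P_def by blast
  then have LP: "P (LEAST v. P v)" by (rule LeastI_ex)
  then obtain g b where g: "g \<in> J" "b \<noteq> 0" "leading (LEAST v. P v) b g" unfolding P_def by blast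
  show thesis
  proof (rule that[OF g])
    fix h assume h: "h \<in> J" "h \<in> span (below (LEAST v. P v))"
    show "h = 0"
    proof (rule ccontr)
      assume "h \<noteq> 0"
      then obtain v c where v: "c \<noteq> 0" "leading v c h" using leading_exists by blast
      then have "P v" using h(1) unfolding P_def by blast
      then have "(LEAST v. P v) \<le> v" by (rule Least_le)
      moreover have "v < (LEAST v. P v)"
        using below_imp_leading_less[OF h(2) v(2,1)] .
      ultimately show False by simp
    qed
  qed
qed

text \<open>The constant is chosen before \<open>f\<close>, so that it serves a whole set of left
  annihilators of \<open>J\<close> at once.\<close>

lemma const_annihilator_right:
  assumes "J \<noteq> {}" "J \<noteq> {0}" and J: "\<And>g r. g \<in> J \<Longrightarrow> \<iota> r * g \<in> J"
  shows "\<exists>b. b \<noteq> 0 \<and> (\<forall>f. (\<forall>g\<in>J. f * g = 0) \<longrightarrow> f * \<iota> b = 0)"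
proof -
  obtain g v b where g: "g \<in> J" "b \<noteq> 0" "leading v b g"
    and min: "\<And>h. h \<in> J \<Longrightarrow> h \<in> span (below v) \<Longrightarrow> h = 0"
    by (rule minimal_leading[OF assms(1,2)]) (rule that)
  have v: "v \<in> words" using g(3) by (simp add: leading_def)
  interpret t: ring_isom "twist v" using v by (rule ring_isom_twist)
  \<comment> \<open>With this preimage, \<open>twist v (c w) * b\<close> equals
    \<open>twist v (c w * b')\<close>, so its vanishing pulls back to
    \<open>c w * b' = 0\<close>.\<close>
  obtain b' where b': "twist v b' = b" using t.surj by (metis surjD)
  show ?thesis
  proof (intro exI[of _ b'] conjI allI impI)
    show "b' \<noteq> 0" using b' g(2) by auto
    fix f assume "\<forall>g\<in>J. f * g = 0"
    then have "f * g = 0" using g(1) by simp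
    obtain F c where F: "finite F" "F \<subseteq> words" "f = (\<Sum>w\<in>F. monom w * \<iota> (c w))"
      using in_span_words[of f] unfolding span_def by blast
    have lead: "leading v (twist v (c w) * b) (\<iota> (c w) * g)" for w
      using g(3) by (rule leading_iota_mult)
    \<comment> \<open>If the coefficient at \<open>v\<close> drops out, the product lies in
      \<open>J\<close> and below the minimal word \<open>v\<close>.\<close>
    have vanish: "\<iota> (c w) * g = 0" if "twist v (c w) * b = 0" for w
      using min[OF J[OF g(1)]] leading_zero_coeff lead[of w] that by simp
    have zero: "monom w * (\<iota> (c w) * g) = 0" if "w \<in> F" for w
    proof (rule sum_eq_zero_distinct_leading[where h = "\<lambda>w. monom w * (\<iota> (c w) * g)" and m = "\<lambda>w. w @ v", OF F(1)])
      show "(\<Sum>w\<in>F. monom w * (\<iota> (c w) * g)) = 0"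
        using \<open>f * g = 0\<close> unfolding F(3) by (simp add: sum_distrib_right mult.assoc)
      fix w assume "w \<in> F"
      then show "monom w * (\<iota> (c w) * g) = 0 \<or>
          (\<exists>b. b \<noteq> 0 \<and> leading (w @ v) b (monom w * (\<iota> (c w) * g)))"
        using leading_monom_mult[OF lead[of w], of w] F(2) vanish[of w]
        by (cases "twist v (c w) * b = 0") auto
    qed (auto intro: append_less_mono_right that)
    then have "twist v (c w) * b = 0" if "w \<in> F" for w
      using leading_monom_mult[OF lead[of w], of w] F(2) that leading_zero_imp
      unfolding zero[OF that] by blast
    then have "c w * b' = 0" if "w \<in> F" for w
      using that b' by (metis t.hom_mult t.hom_0_iff)
    then have "monom w * \<iota> (c w) * \<iota> b' = 0" if "w \<in> F" for w
      using that by (simp add: mult.assoc flip: iota.hom_mult)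
    then show "f * \<iota> b' = 0" unfolding F(3) by (simp add: sum_distrib_right)
  qed
qed

text \<open>Splitting off a leading term with its coefficient on the left lowers the leading word,
  so well-founded induction applies. The bound \<open>w \<le> v\<close> ensures that the split-off
  word does not recur in the remainder.\<close>

lemma left_expansion_leading:
  assumes "leading v b g"
  shows "\<exists>F c. finite F \<and> F \<subseteq> {w \<in> words. w \<le> v} \<and> g = (\<Sum>w\<in>F. \<iota> (c w) * monom w)"
  using assms
proof (induction v arbitrary: b g rule: less_induct)
  case (less v)
  then have v: "v \<in> words" by (simp add: leading_def)
  interpret t: ring_isom "twist v" using v by (rule ring_isom_twist)
  obtain b' where b': "twist v b' = b" using t.surj by (metis surjD)
  \<comment> \<open>The factor \<open>\<iota> (- 1)\<close> subtracts the commutation error, so both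
    copies of \<open>monom v * \<iota> b\<close> cancel.\<close>
  have "(g - monom v * \<iota> b) + (\<iota> b' * monom v - monom v * \<iota> (twist v b')) * \<iota> (- 1) \<in> span (below v)"
    using less.prems v by (intro span_add span_scale iota_mult_monom) (auto simp: leading_def)
  then have g': "g - \<iota> b' * monom v \<in> span (below v)"
    by (simp add: b' iota.hom_uminus algebra_simps)
  show ?case
  proof (cases "g - \<iota> b' * monom v = 0")
    case True
    then show ?thesis using v by (intro exI[of _ "{v}"] exI[of _ "\<lambda>_. b'"]) simp
  next
    case False
    then obtain u d where u: "d \<noteq> 0" "leading u d (g - \<iota> b' * monom v)"
      using leading_exists by blast
    have "u < v" by (rule below_imp_leading_less[OF g' u(2,1)])
    obtain F c where F: "finite F" "F \<subseteq> {w \<in> words. w \<le> u}"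
      "g - \<iota> b' * monom v = (\<Sum>w\<in>F. \<iota> (c w) * monom w)"
      using less.IH[OF \<open>u < v\<close> u(2)] by (elim exE conjE) (rule that)
    have "v \<notin> F" using F(2) \<open>u < v\<close> by auto
    then have "(\<Sum>w\<in>F. \<iota> ((c(v := b')) w) * monom w) = (\<Sum>w\<in>F. \<iota> (c w) * monom w)"
      by (intro sum.cong) auto
    then have "g = (\<Sum>w\<in>insert v F. \<iota> ((c(v := b')) w) * monom w)"
      using F(1) \<open>v \<notin> F\<close> by (simp flip: F(3))
    moreover have "insert v F \<subseteq> {w \<in> words. w \<le> v}" using F(2) v \<open>u < v\<close> by auto
    ultimately show ?thesis using F(1) by blast
  qed
qed

lemma left_expansion: "\<exists>F c. finite F \<and> F \<subseteq> words \<and> g = (\<Sum>w\<in>F. \<iota> (c w) * monom w)"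
proof (cases "g = 0")
  case True
  then show ?thesis by (intro exI[of _ "{}"]) simp
next
  case False
  then obtain v b where "leading v b g" using leading_exists by blast
  from left_expansion_leading[OF this] show ?thesis by blast
qed

text \<open>Mirror image, using left expansions. Right multiplication by a constant does not twist
  the leading coefficient, so \<open>a\<close> itself serves as the witness.\<close>

lemma const_annihilator_left:
  assumes "K \<noteq> {}" "K \<noteq> {0}" and K: "\<And>f r. f \<in> K \<Longrightarrow> f * \<iota> r \<in> K"
  shows "\<exists>a. a \<noteq> 0 \<and> (\<forall>g. (\<forall>f\<in>K. f * g = 0) \<longrightarrow> \<iota> a * g = 0)"
proof -
  obtain f u a where f: "f \<in> K" "a \<noteq> 0" "leading u a f"
    and min: "\<And>h. h \<in> K \<Longrightarrow> h \<in> span (below u) \<Longrightarrow> h = 0"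
    by (rule minimal_leading[OF assms(1,2)]) (rule that)
  show ?thesis
  proof (intro exI[of _ a] conjI allI impI)
    fix g assume "\<forall>f\<in>K. f * g = 0"
    then have "f * g = 0" using f(1) by simp
    obtain F c where F: "finite F" "F \<subseteq> words" "g = (\<Sum>w\<in>F. \<iota> (c w) * monom w)"
      using left_expansion[of g] by blast
    have lead: "leading u (a * c w) (f * \<iota> (c w))" for w
      using f(3) by (rule leading_mult_iota)
    have vanish: "f * \<iota> (c w) = 0" if "a * c w = 0" for w
      using min[OF K[OF f(1)]] leading_zero_coeff lead[of w] that by simp
    have lead': "leading (u @ w) (twist w (a * c w)) (f * \<iota> (c w) * monom w)" if "w \<in> F" for w
      using leading_mult_monom[OF lead] that F(2) by auto
    \<comment> \<open>Injectivity of the twist lets \<open>a * c w\<close> be recovered as zero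
      after \<open>monom w\<close> has been multiplied on.\<close>
    have twist_0: "twist w r = 0 \<longleftrightarrow> r = 0" if "w \<in> F" for w r
    proof -
      interpret ring_isom "twist w" using that F(2) by (auto intro: ring_isom_twist)
      show ?thesis by (rule hom_0_iff)
    qed
    have zero: "f * \<iota> (c w) * monom w = 0" if "w \<in> F" for w
    proof (rule sum_eq_zero_distinct_leading[where h = "\<lambda>w. f * \<iota> (c w) * monom w" and m = "\<lambda>w. u @ w", OF F(1)])
      show "(\<Sum>w\<in>F. f * \<iota> (c w) * monom w) = 0"
        using \<open>f * g = 0\<close> unfolding F(3) by (simp add: sum_distrib_left mult.assoc)
      fix w assume "w \<in> F"
      then show "f * \<iota> (c w) * monom w = 0 \<or>
          (\<exists>b. b \<noteq> 0 \<and> leading (u @ w) b (f * \<iota> (c w) * monom w))"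
        using lead'[of w] vanish[of w] twist_0[of w] by (cases "a * c w = 0") auto
    qed (auto intro: append_less_mono_left that)
    then have "a * c w = 0" if "w \<in> F" for w
      using lead'[OF that] leading_zero_imp twist_0[OF that] unfolding zero[OF that] by blast
    then have "\<iota> a * (\<iota> (c w) * monom w) = 0" if "w \<in> F" for w
      using that by (simp flip: iota.hom_mult mult.assoc)
    then show "\<iota> a * g = 0" unfolding F(3) by (simp add: sum_distrib_left)
  qed (rule f(2))
qed

section \<open>Descent from ideals to constants and the equivalence\<close>

lemma zero_product_ideals_imp:
  fixes I J :: "'s set"
  assumes I: "two_sided_ideal I" "I \<noteq> {0}" and J: "two_sided_ideal J" "J \<noteq> {0}"
    and IJ: "\<forall>f\<in>I. \<forall>g\<in>J. f * g = 0"
  shows "\<exists>a b. a \<noteq> 0 \<and> b \<noteq> 0 \<and> (\<forall>s. \<iota> a * s * \<iota> b = 0)"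
proof -
  have ne: "I \<noteq> {}" "J \<noteq> {}" using I(1) J(1) two_sided_idealD(3) by blast+
  obtain a where a: "a \<noteq> 0" "\<And>g. g \<in> J \<Longrightarrow> \<iota> a * g = 0"
    using const_annihilator_left[OF ne(1) I(2) two_sided_idealD(2)[OF I(1)]] IJ by blast
  obtain b where b: "b \<noteq> 0" "\<And>f. \<forall>g\<in>J. f * g = 0 \<Longrightarrow> f * \<iota> b = 0"
    using const_annihilator_right[OF ne(2) J(2) two_sided_idealD(1)[OF J(1)]] by blast
  \<comment> \<open>\<open>J\<close> absorbs \<open>s\<close> from the left, so
    \<open>\<iota> a * s\<close> still annihilates \<open>J\<close>.\<close>
  have "\<iota> a * s * \<iota> b = 0" for s
    using a(2) two_sided_idealD(1)[OF J(1)] by (intro b(2)) (simp add: mult.assoc)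
  with a(1) b(1) show ?thesis by blast
qed

end

theorem theorem5p5:
  fixes n :: nat
    and \<sigma> :: "'r::ring_1 \<Rightarrow> 'r mat"
    and \<delta> :: "'r \<Rightarrow> 'r vec"
    and \<iota> :: "'r \<Rightarrow> 's::ring_1"
    and x :: "nat \<Rightarrow> 's"
  assumes "n > 0"
    and "matrix_ring_hom n \<sigma>"
    and "right_derivation n \<sigma> \<delta>"
    and "free_skew_extension n \<sigma> \<delta> \<iota> x"
    and "\<forall>r. upper_triangular (\<sigma> r)"
    and "\<forall>i<n. ring_isom (\<lambda>r. \<sigma> r $$ (i, i))"
  shows "prime_ring TYPE('s) \<longleftrightarrow>
    (\<forall>a b :: 'r. a \<noteq> 0 \<and> b \<noteq> 0 \<longrightarrow> {\<iota> a * s * \<iota> b | s. True} \<noteq> {0})"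
proof -
  interpret triangular_skew_extension n \<sigma> \<delta> \<iota> x
    by (rule triangular_skew_extension.intro) (use assms in auto)
  have set_eq: "{\<iota> a * s * \<iota> b | s. True} = {0} \<longleftrightarrow> (\<forall>s. \<iota> a * s * \<iota> b = 0)" for a b
    by auto
  show ?thesis
  proof
    assume "prime_ring TYPE('s)"
    \<comment> \<open>Injectivity of \<open>\<iota>\<close> carries nonzero constants to nonzero
      elements of the extension.\<close>
    then show "\<forall>a b :: 'r. a \<noteq> 0 \<and> b \<noteq> 0 \<longrightarrow> {\<iota> a * s * \<iota> b | s. True} \<noteq> {0}"
      unfolding set_eq using prime_ring_mult_eq_zero by fastforce
  next
    assume "\<forall>a b :: 'r. a \<noteq> 0 \<and> b \<noteq> 0 \<longrightarrow> {\<iota> a * s * \<iota> b | s. True} \<noteq> {0}"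
    then have *: "\<not> (\<exists>a b. a \<noteq> 0 \<and> b \<noteq> 0 \<and> (\<forall>s. \<iota> a * s * \<iota> b = 0))"
      unfolding set_eq by blast
    show "prime_ring TYPE('s)"
      unfolding prime_ring_def
    proof (intro allI impI)
      fix I J :: "'s set"
      assume "two_sided_ideal I \<and> two_sided_ideal J \<and> I \<noteq> {0} \<and> J \<noteq> {0}"
      then show "ideal_product I J \<noteq> {0}"
        using * zero_product_ideals_imp[of I J] ideal_product_eq_zero_iff[of I J] by blast
    qed
  qed
qed

end
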